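(* Let $q\ge 3$ be a fixed odd integer. For positive integers $n$, the minimum redundancy $r_{\rm PB}(n,q)$ of polarity-balanced codes of length $n$ over ${\cal A}_q$ satisfies $$r_{\rm PB}(n,q)=n-\log_q M_{\rm PB}(n,q)\approx \frac12\log_q n+\frac12\log_q\frac{2\pi(q-1)}{q},$$ where $\approx$ means that the difference of the two sides tends to $0$ as $n\to\infty$.
   Context: For an integer $q\ge 2$, ${\cal A}_q=\{-q+1,-q+3,-q+5,\ldots,q-3,q-1\}$. A sequence ${\bf x}=(x_1,\ldots,x_n)\in({\cal A}_q)^n$ is polarity-balanced (PB) if $|\{i:x_i>0\}|=|\{i:x_i<0\}|$; $M_{\rm PB}(n,q)$ is the number of PB sequences in $({\cal A}_q)^n$. A code of length $n$ is a set of sequences of length $n$; it is PB if all its codewords are PB. The redundancy of a $q$-ary code of length $n$ and size $M$ is $n-\log_q M$, and $r_{\rm PB}(n,q)$ is the minimum redundancy among (nonempty) PB codes of length $n$ over ${\cal A}_q$. *)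

theory Defs
  imports "HOL-Analysis.Analysis"
begin

definition alphabet :: "nat \<Rightarrow> int set" where
  "alphabet q = {2 * int j - int q + 1 | j. j < q}"

definition sequences :: "nat \<Rightarrow> nat \<Rightarrow> int list set" where
  "sequences n q = {xs. length xs = n \<and> set xs \<subseteq> alphabet q}"

definition polarity_balanced :: "int list \<Rightarrow> bool" where
  "polarity_balanced xs \<longleftrightarrow>
     card {i. i < length xs \<and> xs ! i > 0} = card {i. i < length xs \<and> xs ! i < 0}"

definition M_PB :: "nat \<Rightarrow> nat \<Rightarrow> nat" where
  "M_PB n q = card {xs \<in> sequences n q. polarity_balanced xs}"

definition PB_code :: "nat \<Rightarrow> nat \<Rightarrow> int list set \<Rightarrow> bool" where
  "PB_code n q C \<longleftrightarrow> C \<subseteq> sequences n q \<and> (\<forall>xs\<in>C. polarity_balanced xs)"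

definition redundancy :: "nat \<Rightarrow> nat \<Rightarrow> int list set \<Rightarrow> real" where
  "redundancy n q C = real n - log (real q) (real (card C))"

text \<open>There are finitely many codes of a given length, so the minimum exists as soon as there is
  a nonempty one; for odd \<open>q\<close> the all-zero sequence provides one.\<close>

definition r_PB :: "nat \<Rightarrow> nat \<Rightarrow> real" where
  "r_PB n q = Min {redundancy n q C | C. PB_code n q C \<and> C \<noteq> {}}"

lemma finite_redundancies: "finite {redundancy n q C | C. PB_code n q C \<and> C \<noteq> {}}"
proof -
  have "alphabet q = (\<lambda>j. 2 * int j - int q + 1) ` {..<q}"
    by (auto simp: alphabet_def)
  hence "finite (alphabet q)"
    by simp
  hence "finite {xs. set xs \<subseteq> alphabet q \<and> length xs = n}"
    by (rule finite_lists_length_eq)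
  hence "finite (sequences n q)"
    by (simp add: sequences_def conj_commute)
  hence "finite (redundancy n q ` Pow (sequences n q))"
    by simp
  moreover have "{redundancy n q C | C. PB_code n q C \<and> C \<noteq> {}}
      \<subseteq> redundancy n q ` Pow (sequences n q)"
    by (auto simp: PB_code_def)
  ultimately show ?thesis
    by (rule rev_finite_subset)
qed

lemma redundancies_nonempty:
  assumes "odd q"
  shows "{redundancy n q C | C. PB_code n q C \<and> C \<noteq> {}} \<noteq> {}"
proof -
  obtain k where "q = 2 * k + 1"
    using assms by (rule oddE)
  hence "0 \<in> alphabet q"
    by (auto simp: alphabet_def intro!: exI[of _ k])
  hence "replicate n 0 \<in> sequences n q"
    by (auto simp: sequences_def)
  moreover have "polarity_balanced (replicate n 0)"
    by (simp add: polarity_balanced_def cong: conj_cong)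
  ultimately have "PB_code n q {replicate n 0}"
    by (simp add: PB_code_def)
  thus ?thesis
    by blast
qed

end

theory Submission
  imports Defs "HOL-Probability.Distributions" "HOL-Real_Asymp.Real_Asymp"
begin

text \<open>With \<open>q = 2m + 1\<close>, the number of balanced sequences is the constant term of
  \<open>(m z + 1 + m / z)\<^sup>n\<close>, i.e. the integral of \<open>(1 + 2 m cos \<theta>)\<^sup>n / 2\<pi>\<close> over \<open>[-\<pi>, \<pi>]\<close>.
  Dividing by \<open>q\<^sup>n\<close> and putting \<open>c = (q - 1) / q\<close>, the integrand becomes
  \<open>(1 - c (1 - cos \<theta>))\<^sup>n\<close>, and Laplace's method (substitute \<open>\<theta> = t / \<surd>n\<close> and apply dominated
  convergence) gives \<open>M \<sim> q\<^sup>n / \<surd>(2 \<pi> c n)\<close>. The optimal code consists of all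
  balanced sequences.\<close>

section \<open>Optimal codes\<close>

text \<open>Halving the letters gives an interval symmetric about 0, so the \<open>m\<close>
  negative letters, the single 0 and the \<open>m\<close> positive letters become visible.\<close>

lemma alphabet_odd: "alphabet (2 * m + 1) = (\<lambda>i. 2 * i) ` {- int m..int m}"
proof (intro set_eqI iffI)
  fix x assume "x \<in> alphabet (2 * m + 1)"
  then obtain j where "j < 2 * m + 1" "x = 2 * int j - int (2 * m + 1) + 1"
    by (auto simp: alphabet_def)
  hence "x = 2 * (int j - int m)" "int j - int m \<in> {- int m..int m}" by auto
  thus "x \<in> (\<lambda>i. 2 * i) ` {- int m..int m}" by blast
next
  fix x assume "x \<in> (\<lambda>i. 2 * i) ` {- int m..int m}"
  then obtain i where "i \<in> {- int m..int m}" "x = 2 * i" by blast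
  thus "x \<in> alphabet (2 * m + 1)"
    by (auto simp: alphabet_def intro!: exI[of _ "nat (i + int m)"])
qed

lemma finite_alphabet: "finite (alphabet q)"
proof -
  have "alphabet q = (\<lambda>j. 2 * int j - int q + 1) ` {..<q}"
    by (auto simp: alphabet_def)
  thus ?thesis by simp
qed

lemma finite_sequences: "finite (sequences n q)"
  using finite_lists_length_eq[OF finite_alphabet, of q n]
  by (simp add: sequences_def conj_commute)

lemma r_PB_eq:
  assumes "q \<ge> 2" "odd q"
  shows "r_PB n q = real n - log (real q) (real (M_PB n q))"
  unfolding r_PB_def
proof (rule Min_eqI[OF finite_redundancies])
  let ?B = "{xs \<in> sequences n q. polarity_balanced xs}"
  have finB: "finite ?B" using finite_sequences by simp
  fix y assume "y \<in> {redundancy n q C | C. PB_code n q C \<and> C \<noteq> {}}"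
  then obtain C where C: "y = redundancy n q C" "PB_code n q C" "C \<noteq> {}" by blast
  have sub: "C \<subseteq> ?B" using C(2) by (auto simp: PB_code_def)
  have "card C \<le> M_PB n q" unfolding M_PB_def by (rule card_mono[OF finB sub])
  \<comment> \<open>\<open>log\<close> is monotone only on positive arguments; since
    \<open>log b 0 = 0\<close>, an empty code would get the redundancy \<open>n\<close>.\<close>
  moreover have "card C > 0" using C(3) finite_subset[OF sub finB] by (simp add: card_gt_0_iff)
  ultimately show "real n - log (real q) (real (M_PB n q)) \<le> y"
    using assms(1) by (simp add: C(1) redundancy_def)
next
  let ?B = "{xs \<in> sequences n q. polarity_balanced xs}"
  obtain C where "PB_code n q C" "C \<noteq> {}"
    using redundancies_nonempty[OF assms(2), of n] by blast
  hence "?B \<noteq> {}" by (auto simp: PB_code_def)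
  moreover have "PB_code n q ?B" by (auto simp: PB_code_def)
  moreover have "redundancy n q ?B = real n - log (real q) (real (M_PB n q))"
    by (simp add: redundancy_def M_PB_def)
  ultimately show "real n - log (real q) (real (M_PB n q))
      \<in> {redundancy n q C | C. PB_code n q C \<and> C \<noteq> {}}"
    by (metis (mono_tags, lifting) mem_Collect_eq)
qed

section \<open>Counting by Fourier inversion\<close>

lemma sum_list_sgn:
  fixes xs :: "int list"
  shows "sum_list (map sgn xs) =
    int (card {i. i < length xs \<and> xs ! i > 0}) - int (card {i. i < length xs \<and> xs ! i < 0})"
proof -
  have "sum_list (map sgn xs) = (\<Sum>i<length xs. of_bool (xs ! i > 0) - of_bool (xs ! i < 0))"
    by (auto simp: sum_list_sum_nth atLeast0LessThan sgn_if intro!: sum.cong)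
  also have "\<dots> = int (card ({..<length xs} \<inter> {i. xs ! i > 0}))
      - int (card ({..<length xs} \<inter> {i. xs ! i < 0}))"
    by (simp add: sum_subtractf)
  also have "{..<length xs} \<inter> {i. xs ! i > 0} = {i. i < length xs \<and> xs ! i > 0}"
    by auto
  also have "{..<length xs} \<inter> {i. xs ! i < 0} = {i. i < length xs \<and> xs ! i < 0}"
    by auto
  finally show ?thesis .
qed

text \<open>Balance becomes the vanishing of an additive integer statistic, which Fourier
  orthogonality can detect and which splits letter by letter.\<close>

lemma polarity_balanced_iff: "polarity_balanced xs \<longleftrightarrow> sum_list (map sgn xs) = 0"
  by (simp add: polarity_balanced_def sum_list_sgn)

text \<open>Source of the weights \<open>m\<close>, 1, \<open>m\<close> in the trinomial. The
  function \<open>g\<close> stays arbitrary so that a shifted cosine can be substituted.\<close>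

lemma sum_sgn_alphabet:
  fixes g :: "int \<Rightarrow> real"
  shows "(\<Sum>a\<in>alphabet (2 * m + 1). g (sgn a)) = real m * g (-1) + g 0 + real m * g 1"
proof -
  have split: "{- int m..int m} = {- int m..-1} \<union> ({0} \<union> {1..int m})" by auto
  have "(\<Sum>a\<in>alphabet (2 * m + 1). g (sgn a)) = (\<Sum>i\<in>{- int m..int m}. g (sgn i))"
    unfolding alphabet_odd by (subst sum.reindex) (auto simp: inj_on_def sgn_mult)
  also have "\<dots> = (\<Sum>i\<in>{- int m..-1}. g (sgn i))
      + ((\<Sum>i\<in>{0}. g (sgn i)) + (\<Sum>i\<in>{1..int m}. g (sgn i)))"
    unfolding split by (subst sum.union_disjoint, auto)+
  also have "(\<Sum>i\<in>{- int m..-1}. g (sgn i)) = (\<Sum>i\<in>{- int m..-1}. g (-1))"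
    by (intro sum.cong) auto
  also have "(\<Sum>i\<in>{1..int m}. g (sgn i)) = (\<Sum>i\<in>{1..int m}. g 1)"
    by (intro sum.cong) auto
  finally show ?thesis by simp
qed

lemma sequences_0: "sequences 0 q = {[]}"
  by (auto simp: sequences_def)

lemma sequences_Suc: "sequences (Suc n) q = (\<lambda>(a, xs). a # xs) ` (alphabet q \<times> sequences n q)"
  by (auto simp: sequences_def length_Suc_conv image_iff)

text \<open>The shift \<open>k\<close> makes the induction go through with cosines alone.\<close>

lemma sum_cos_sequences:
  "(\<Sum>xs\<in>sequences n (2 * m + 1). cos (real_of_int (sum_list (map sgn xs) + k) * \<theta>))
     = (1 + 2 * real m * cos \<theta>) ^ n * cos (real_of_int k * \<theta>)"
proof (induction n arbitrary: k)
  case 0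
  show ?case by (simp add: sequences_0)
next
  case (Suc n)
  let ?q = "2 * m + 1" and ?P = "1 + 2 * real m * cos \<theta>"
  have "(\<Sum>xs\<in>sequences (Suc n) ?q. cos (real_of_int (sum_list (map sgn xs) + k) * \<theta>))
      = (\<Sum>a\<in>alphabet ?q. \<Sum>xs\<in>sequences n ?q.
           cos (real_of_int (sum_list (map sgn xs) + (sgn a + k)) * \<theta>))"
    unfolding sequences_Suc
    by (subst sum.reindex) (auto simp: inj_on_def sum.cartesian_product algebra_simps intro!: sum.cong)
  also have "\<dots> = (\<Sum>a\<in>alphabet ?q. ?P ^ n * cos (real_of_int (sgn a + k) * \<theta>))"
    by (simp only: Suc)
  also have "\<dots> = ?P ^ n * (real m * cos (real_of_int (-1 + k) * \<theta>)
      + cos (real_of_int (0 + k) * \<theta>) + real m * cos (real_of_int (1 + k) * \<theta>))"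
    by (subst sum_sgn_alphabet[of "\<lambda>s. ?P ^ n * cos (real_of_int (s + k) * \<theta>)"])
      (simp add: algebra_simps)
  \<comment> \<open>The outer terms combine by cos((k-1)\<theta>) + cos((k+1)\<theta>) = 2
    cos(\<theta>) cos(k\<theta>), which produces one more factor \<open>?P\<close>.\<close>
  also have "\<dots> = ?P ^ Suc n * cos (real_of_int k * \<theta>)"
    by (simp add: algebra_simps cos_add cos_diff)
  finally show ?case .
qed

text \<open>Orthogonality: for nonzero \<open>k\<close> the antiderivative is a multiple of
  sin(k\<theta>), which vanishes at both endpoints.\<close>

lemma integral_cos_int:
  "(LBINT \<theta>. indicator {-pi..pi} \<theta> *\<^sub>R cos (real_of_int k * \<theta>)) = (if k = 0 then 2 * pi else 0)"
proof (cases "k = 0")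
  case True
  thus ?thesis by simp
next
  case False
  have "((\<lambda>\<theta>. sin (real_of_int k * \<theta>) / real_of_int k) has_vector_derivative cos (real_of_int k * x))
      (at x within {-pi..pi})" for x
    unfolding has_real_derivative_iff_has_vector_derivative[symmetric]
    using False by (auto intro!: derivative_eq_intros)
  from integral_FTC_Icc[OF _ this] show ?thesis
    using False by (simp add: continuous_intros mult.commute)
qed

text \<open>Integrate \<open>sum_cos_sequences\<close> with \<open>k = 0\<close> term by term: a
  balanced sequence contributes \<open>2 * pi\<close>, any other contributes 0.\<close>

lemma M_PB_integral:
  "2 * pi * real (M_PB n (2 * m + 1))
     = (LBINT \<theta>. indicator {-pi..pi} \<theta> *\<^sub>R (1 + 2 * real m * cos \<theta>) ^ n)"
proof -
  let ?S = "sequences n (2 * m + 1)"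
  have "(LBINT \<theta>. indicator {-pi..pi} \<theta> *\<^sub>R (1 + 2 * real m * cos \<theta>) ^ n)
      = (LBINT \<theta>. (\<Sum>xs\<in>?S. indicator {-pi..pi} \<theta> *\<^sub>R cos (real_of_int (sum_list (map sgn xs)) * \<theta>)))"
    using sum_cos_sequences[where n = n and m = m and k = 0]
    by (simp add: sum_distrib_left[symmetric])
  also have "\<dots> = (\<Sum>xs\<in>?S. LBINT \<theta>. indicator {-pi..pi} \<theta> *\<^sub>R cos (real_of_int (sum_list (map sgn xs)) * \<theta>))"
  proof (rule Bochner_Integration.integral_sum)
    fix xs
    show "integrable lborel (\<lambda>\<theta>. indicator {-pi..pi} \<theta> *\<^sub>R cos (real_of_int (sum_list (map sgn xs)) * \<theta>))"
      using borel_integrable_atLeastAtMost'[of "-pi" pi "\<lambda>\<theta>. cos (real_of_int (sum_list (map sgn xs)) * \<theta>)"]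
      by (simp add: set_integrable_def continuous_intros)
  qed
  also have "\<dots> = (\<Sum>xs\<in>?S. if polarity_balanced xs then 2 * pi else 0)"
    by (simp only: integral_cos_int polarity_balanced_iff)
  also have "\<dots> = 2 * pi * real (M_PB n (2 * m + 1))"
    using finite_sequences
    by (simp add: M_PB_def sum.If_cases Int_def)
  finally show ?thesis by simp
qed

section \<open>Laplace's method\<close>

text \<open>A concave function lies above its chord, here the one from (0, 0) to (pi/2, 1).\<close>

lemma jordan_sin:
  fixes x :: real
  assumes "0 \<le> x" "x \<le> pi / 2"
  shows "2 / pi * x \<le> sin x"
proof -
  have "concave_on {0..pi / 2} sin"
    by (rule f''_le0_imp_concave[where f' = cos and f'' = "\<lambda>x. - sin x"])
      (auto intro!: derivative_eq_intros sin_ge_zero)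
  from concave_onD_Icc'[OF this, of x] show ?thesis using assms by simp
qed

text \<open>Jordan's inequality at half the angle, through 1 - cos x = 2 sin(x/2)^2.\<close>

lemma one_minus_cos_ge:
  fixes x :: real
  assumes "\<bar>x\<bar> \<le> pi"
  shows "2 * x\<^sup>2 / pi\<^sup>2 \<le> 1 - cos x"
proof -
  have "2 / pi * (\<bar>x\<bar> / 2) \<le> sin (\<bar>x\<bar> / 2)" using assms by (intro jordan_sin) auto
  hence "(\<bar>x\<bar> / pi)\<^sup>2 \<le> (sin (\<bar>x\<bar> / 2))\<^sup>2" by (intro power_mono) auto
  moreover have "cos \<bar>x\<bar> = 1 - 2 * (sin (\<bar>x\<bar> / 2))\<^sup>2"
    using cos_double_sin[of "\<bar>x\<bar> / 2"] by simp
  ultimately show ?thesis by (simp add: power_divide)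
qed

text \<open>The rate is dictated by the endpoints x = \<plusminus>pi, where the kernel is 1 - 2c, of
  absolute value 1 - 2(1 - c). The condition c \<ge> 1/2 makes this rate also small enough for the
  decay near 0.\<close>

lemma kernel_bound:
  fixes c x :: real
  assumes "1 / 2 \<le> c" "c < 1" "\<bar>x\<bar> \<le> pi"
  shows "\<bar>1 - c * (1 - cos x)\<bar> \<le> exp (- (2 * (1 - c) / pi\<^sup>2) * x\<^sup>2)"
proof -
  define u where "u = x\<^sup>2 / pi\<^sup>2"
  have u: "0 \<le> u" "u \<le> 1" using assms(3) by (auto simp: u_def abs_le_square_iff[symmetric])
  have "2 * u \<le> 1 - cos x" using one_minus_cos_ge[OF assms(3)] by (simp add: u_def)
  hence "c * (2 * u) \<le> c * (1 - cos x)" using assms by (intro mult_left_mono) auto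
  moreover have "(1 - c) * (2 * u) \<le> c * (2 * u)" using assms u by (intro mult_right_mono) auto
  ultimately have 1: "1 - c * (1 - cos x) \<le> 1 - 2 * (1 - c) * u"
    by (simp add: algebra_simps)
  have "c * (1 - cos x) \<le> c * 2" using assms by (intro mult_left_mono) auto
  moreover have "(1 - c) * u \<le> 1 - c" using assms u by (simp add: mult_left_le)
  ultimately have 2: "c * (1 - cos x) - 1 \<le> 1 - 2 * (1 - c) * u" by (simp add: algebra_simps)
  have "\<bar>1 - c * (1 - cos x)\<bar> \<le> 1 - 2 * (1 - c) * u" using 1 2 by linarith
  also have "\<dots> \<le> exp (- (2 * (1 - c) * u))" by (rule exp_minus_ge)
  finally show ?thesis by (simp add: u_def)
qed

lemma gaussian_integral:
  fixes a :: real
  assumes "a > 0"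
  shows "integrable lborel (\<lambda>x. exp (- a * x\<^sup>2))" "(LBINT x. exp (- a * x\<^sup>2)) = sqrt (pi / a)"
proof -
  \<comment> \<open>The variance 1/(2a) turns the exponent of the centred normal density into -a
    x^2; its normalising constant is then sqrt(pi/a).\<close>
  let ?\<sigma> = "1 / sqrt (2 * a)"
  have s: "?\<sigma> > 0" using assms by simp
  have eq: "(\<lambda>x. exp (- a * x\<^sup>2)) = (\<lambda>x. sqrt (pi / a) * normal_density 0 ?\<sigma> x)"
    using assms by (auto simp: normal_density_def fun_eq_iff power_divide real_sqrt_divide field_simps)
  show "integrable lborel (\<lambda>x. exp (- a * x\<^sup>2))"
    unfolding eq using s by (intro integrable_mult_right integrable_normal_density)
  show "(LBINT x. exp (- a * x\<^sup>2)) = sqrt (pi / a)"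
    unfolding eq using s by simp
qed

lemma laplace_kernel:
  fixes c :: real
  assumes c: "1 / 2 \<le> c" "c < 1"
  shows "(\<lambda>n. sqrt (real n) * (LBINT \<theta>. indicator {-pi..pi} \<theta> *\<^sub>R (1 - c * (1 - cos \<theta>)) ^ n))
    \<longlonglongrightarrow> sqrt (2 * pi / c)"
proof -
  define f where "f n \<theta> = indicator {-pi..pi} \<theta> *\<^sub>R (1 - c * (1 - cos \<theta>)) ^ n" for n :: nat and \<theta> :: real
  define a where "a = 2 * (1 - c) / pi\<^sup>2"
  have a: "a > 0" using c by (simp add: a_def)
  \<comment> \<open>For \<open>n = 0\<close> the junk value \<open>t / 0 = 0\<close> would break the dominating bound.\<close>
  define g where "g n t = (if n = 0 then 0 else f n (t / sqrt (real n)))" for n t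
  have "(\<lambda>n. LBINT t. g n t) \<longlonglongrightarrow> (LBINT t. exp (- (c / 2) * t\<^sup>2))"
  proof (rule integral_dominated_convergence[where w = "\<lambda>t. exp (- a * t\<^sup>2)"])
    show "(\<lambda>t. exp (- (c / 2) * t\<^sup>2)) \<in> borel_measurable lborel" by measurable
    show "g n \<in> borel_measurable lborel" for n unfolding g_def f_def by measurable
    show "integrable lborel (\<lambda>t. exp (- a * t\<^sup>2))" by (rule gaussian_integral(1)[OF a])
    show "AE t in lborel. (\<lambda>n. g n t) \<longlonglongrightarrow> exp (- (c / 2) * t\<^sup>2)"
    proof (rule AE_I2)
      fix t :: real
      \<comment> \<open>Here 1 - cos(t / sqrt n) is asymptotic to t^2 / (2n), so this is the limit
        defining the exponential.\<close>
      have "(\<lambda>n. (1 - c * (1 - cos (t / sqrt (real n)))) ^ n) \<longlonglongrightarrow> exp (- (c * (t * t) / 2))"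
        by real_asymp
      \<comment> \<open>For fixed \<open>t\<close> the rescaled window eventually contains
        \<open>t\<close>, so the indicator does not affect the pointwise limit.\<close>
      moreover have "\<forall>\<^sub>F n in sequentially.
          (1 - c * (1 - cos (t / sqrt (real n)))) ^ n = g n t"
      proof -
        have "(\<lambda>n. t / sqrt (real n)) \<longlonglongrightarrow> 0" by real_asymp
        from tendstoD[OF this pi_gt_zero] eventually_gt_at_top[of 0] show ?thesis
        proof eventually_elim
          case (elim n)
          hence "t / sqrt (real n) \<in> {-pi..pi}"
            unfolding dist_real_def by (simp only: atLeastAtMost_iff) linarith
          thus ?case using elim by (simp add: g_def f_def)
        qed
      qed
      ultimately have "(\<lambda>n. g n t) \<longlonglongrightarrow> exp (- (c * (t * t) / 2))"
        by (rule Lim_transform_eventually)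
      thus "(\<lambda>n. g n t) \<longlonglongrightarrow> exp (- (c / 2) * t\<^sup>2)" by (simp add: power2_eq_square)
    qed
    show "AE t in lborel. norm (g n t) \<le> exp (- a * t\<^sup>2)" for n
    proof (rule AE_I2)
      fix t :: real
      show "norm (g n t) \<le> exp (- a * t\<^sup>2)"
      \<comment> \<open>Inside the window the n-th power of the Gaussian bound at t / sqrt n is free
        of \<open>n\<close>; otherwise \<open>g n t\<close> is 0.\<close>
      proof (cases "n > 0 \<and> \<bar>t / sqrt (real n)\<bar> \<le> pi")
        case True
        let ?x = "t / sqrt (real n)"
        have "?x \<in> {-pi..pi}" using True unfolding abs_le_iff atLeastAtMost_iff by linarith
        hence "norm (g n t) = \<bar>1 - c * (1 - cos ?x)\<bar> ^ n"
          using True by (simp add: g_def f_def power_abs)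
        also have "\<dots> \<le> exp (- a * ?x\<^sup>2) ^ n"
          unfolding a_def using kernel_bound[OF c] True by (intro power_mono) auto
        also have "\<dots> = exp (- a * t\<^sup>2)"
          using True by (simp add: exp_of_nat_mult[symmetric] power_divide)
        finally show ?thesis .
      next
        case False
        hence "n = 0 \<or> t / sqrt (real n) \<notin> {-pi..pi}"
          by (auto simp only: atLeastAtMost_iff abs_le_iff)
        thus ?thesis by (auto simp: g_def f_def simp del: atLeastAtMost_iff)
      qed
    qed
  qed
  also have "(LBINT t. exp (- (c / 2) * t\<^sup>2)) = sqrt (2 * pi / c)"
    using gaussian_integral(2)[of "c / 2"] c by (simp add: mult.commute)
  finally have lim: "(\<lambda>n. LBINT t. g n t) \<longlonglongrightarrow> sqrt (2 * pi / c)" .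
  have "\<forall>\<^sub>F n in sequentially. (LBINT t. g n t) = sqrt (real n) * (LBINT \<theta>. f n \<theta>)"
    using eventually_gt_at_top[of 0]
  proof eventually_elim
    case (elim n)
    \<comment> \<open>The substitution \<theta> = t / sqrt n; its Jacobian accounts for the factor
      sqrt n in the claim.\<close>
    have "(LBINT \<theta>. f n \<theta>) = \<bar>1 / sqrt (real n)\<bar> *\<^sub>R (LBINT t. f n (0 + 1 / sqrt (real n) * t))"
      using elim by (intro lborel_integral_real_affine) auto
    thus ?case using elim by (simp add: g_def)
  qed
  from Lim_transform_eventually[OF lim this] show ?thesis by (simp add: f_def)
qed

section \<open>Asymptotics of the count and of the redundancy\<close>

lemma M_PB_asymptotics:
  assumes "m \<ge> 1" and q: "q = 2 * m + 1"
  shows "(\<lambda>n. sqrt (real n) * real (M_PB n q) / real q ^ n)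
    \<longlonglongrightarrow> 1 / sqrt (2 * pi * (real q - 1) / real q)"
proof -
  define c where "c = (real q - 1) / real q"
  \<comment> \<open>Since c = 2m / (2m + 1) and m \<ge> 1, in fact c \<ge> 2/3.\<close>
  have c: "1 / 2 \<le> c" "c < 1" using assms by (auto simp: c_def field_simps)
  have "1 + 2 * real m * cos x = real q * (1 - c * (1 - cos x))" for x
    using q by (simp add: c_def field_simps)
  hence "2 * pi * real (M_PB n q)
      = real q ^ n * (LBINT \<theta>. indicator {-pi..pi} \<theta> *\<^sub>R (1 - c * (1 - cos \<theta>)) ^ n)" for n
    using M_PB_integral[of n m, folded q] by (simp add: power_mult_distrib mult.left_commute)
  hence "(LBINT \<theta>. indicator {-pi..pi} \<theta> *\<^sub>R (1 - c * (1 - cos \<theta>)) ^ n)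
      = 2 * pi * real (M_PB n q) / real q ^ n" for n
    using q by simp
  from laplace_kernel[OF c, unfolded this]
  have "(\<lambda>n. 1 / (2 * pi) * (sqrt (real n) * (2 * pi * real (M_PB n q) / real q ^ n)))
      \<longlonglongrightarrow> 1 / (2 * pi) * sqrt (2 * pi / c)"
    by (intro tendsto_intros)
  moreover have "1 / (2 * pi) * sqrt (2 * pi / c) = 1 / sqrt (2 * pi * c)"
    using c by (simp add: real_sqrt_divide real_sqrt_mult field_simps)
  ultimately show ?thesis by (simp add: c_def)
qed

theorem corollary8:
  fixes q :: nat
  assumes "q \<ge> 3" and "odd q"
  shows "(\<forall>n\<ge>1. r_PB n q = real n - log (real q) (real (M_PB n q))) \<and>
    (\<lambda>n. r_PB n q -
       (1/2 * log (real q) (real n) + 1/2 * log (real q) (2 * pi * (real q - 1) / real q)))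
      \<longlonglongrightarrow> 0"
proof
  show "\<forall>n\<ge>1. r_PB n q = real n - log (real q) (real (M_PB n q))"
    using r_PB_eq assms by simp
next
  obtain m where q: "q = 2 * m + 1" using assms(2) by (rule oddE)
  have m: "m \<ge> 1" using q assms(1) by simp
  define K where "K = 2 * pi * (real q - 1) / real q"
  have K: "K > 0" using assms(1) by (simp add: K_def)
  \<comment> \<open>The normalised count has a finite positive limit, at which \<open>log\<close> is
    continuous; \<open>- log q (R n)\<close> is the redundancy minus its growing term.\<close>
  define R where "R n = sqrt (real n) * real (M_PB n q) / real q ^ n" for n
  have R: "R \<longlonglongrightarrow> 1 / sqrt K" unfolding R_def K_def by (rule M_PB_asymptotics[OF m q])
  have "(\<lambda>n. - log (real q) (R n) - 1/2 * log (real q) K)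
      \<longlonglongrightarrow> - log (real q) (1 / sqrt K) - 1/2 * log (real q) K"
    using assms(1) K by (intro tendsto_intros R) auto
  also have "- log (real q) (1 / sqrt K) - 1/2 * log (real q) K = 0"
    using K assms(1) by (simp add: log_divide log_def ln_sqrt ln_div)
  finally have lim: "(\<lambda>n. - log (real q) (R n) - 1/2 * log (real q) K) \<longlonglongrightarrow> 0" .
  \<comment> \<open>Positivity of \<open>R n\<close> forces both \<open>n\<close> and
    \<open>M_PB n q\<close> to be positive, so that the logarithm of the product splits.\<close>
  have "\<forall>\<^sub>F n in sequentially. R n > 0"
    using order_tendstoD(1)[OF R, of 0] K by simp
  hence "\<forall>\<^sub>F n in sequentially. - log (real q) (R n) - 1/2 * log (real q) K =
      r_PB n q - (1/2 * log (real q) (real n) + 1/2 * log (real q) K)"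
  proof eventually_elim
    case (elim n)
    hence pos: "n > 0" "M_PB n q > 0"
      using assms(1) by (auto simp: R_def zero_less_mult_iff zero_less_divide_iff)
    have "log (real q) (R n) = 1/2 * log (real q) (real n) + log (real q) (real (M_PB n q)) - real n"
      using pos assms(1)
      by (simp add: R_def log_divide log_mult log_nat_power log_def ln_sqrt ln_div ln_mult ln_realpow field_simps)
    thus ?case using r_PB_eq[of q n] assms by simp
  qed
  from Lim_transform_eventually[OF lim this]
  show "(\<lambda>n. r_PB n q -
       (1/2 * log (real q) (real n) + 1/2 * log (real q) (2 * pi * (real q - 1) / real q)))
      \<longlonglongrightarrow> 0"
    by (simp add: K_def)
qed

end
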